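(* Let $\mathcal H$ be a real Hilbert space, let $f_1,f_2:\mathcal H\to(-\infty,+\infty]$ be proper lower semicontinuous convex functions, and let $\lambda_1,\lambda_2>0$ with $\lambda_1+\lambda_2=1$. Let $\bar\phi$ be the dual solution, i.e. the (unique) solution, assumed to exist, of $$\max_{\phi\in\mathcal H}\Big[-\Big(\frac{f_1}{\lambda_2}\Big)^*(-\phi)-\Big(\frac{f_2}{\lambda_1}\Big)^*(\phi)-\frac{\|\phi\|^2}{2}\Big].$$ Let $F:=\operatorname{Fix}(\operatorname{Prox}_{f_2/\lambda_1}\operatorname{Prox}_{f_1/\lambda_2})$ and define $T_2:F\to\operatorname{Fix}(\lambda_1\operatorname{Prox}_{f_1}+\lambda_2\operatorname{Prox}_{f_2})$ by $$T_2(y)=\lambda_1\operatorname{Prox}_{f_1/\lambda_2}(y)+\lambda_2y=y+\lambda_1\bar\phi$$ (in particular the two expressions agree on $F$). Then $T_2$ is a homeomorphism with $T_2^{-1}(z)=\operatorname{Prox}_{f_2}(z)$. Consequently, $$\operatorname{Fix}(\lambda_1\operatorname{Prox}_{f_1}+\lambda_2\operatorname{Prox}_{f_2})=F+\lambda_1\bar\phi.$$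
   Context: For proper lower semicontinuous convex $f$ on $\mathcal H$: $\operatorname{Prox}_f:=(\operatorname{Id}+\partial f)^{-1}$ is the proximal mapping (single-valued, full domain), with $\partial f$ the convex subdifferential; $f^*(x^* )=\sup_x(\langle x^*,x\rangle-f(x))$ is the Fenchel conjugate. $\operatorname{Fix}T=\{x:Tx=x\}$. A solution of the dual problem is a point at which the maximum is attained with finite value. A homeomorphism is a continuous bijection with continuous inverse (norm topology). *)

theory Defs
  imports "HOL-Analysis.Analysis"
begin

text \<open>
  A real Hilbert space is a type of sort \<open>{real_inner, complete_space}\<close>; functions with values in
  \<open>(-\<infinity>, +\<infinity>]\<close> are \<^typ>\<open>ereal\<close>-valued functions for which properness includes \<open>f x \<noteq> -\<infinity>\<close>.
\<close>

definition proper :: "('a \<Rightarrow> ereal) \<Rightarrow> bool" where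
  "proper f \<longleftrightarrow> (\<forall>x. f x \<noteq> -\<infinity>) \<and> (\<exists>x. f x \<noteq> \<infinity>)"

definition lower_semicont :: "('a::topological_space \<Rightarrow> ereal) \<Rightarrow> bool" where
  "lower_semicont f \<longleftrightarrow> (\<forall>x. f x \<le> Liminf (at x) f)"

text \<open>For \<open>f > -\<infinity>\<close> no \<open>\<infinity> - \<infinity>\<close> occurs on the right; the cases \<open>t = 0\<close> and \<open>t = 1\<close> hold trivially
  by the convention \<open>0 * \<infinity> = 0\<close>.\<close>

definition convex_ereal :: "('a::real_vector \<Rightarrow> ereal) \<Rightarrow> bool" where
  "convex_ereal f \<longleftrightarrow>
     (\<forall>x y. \<forall>t\<in>{0..1::real}. f ((1 - t) *\<^sub>R x + t *\<^sub>R y) \<le> ereal (1 - t) * f x + ereal t * f y)"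

text \<open>For proper \<open>f\<close> this is empty at every \<open>x\<close> with \<open>f x = \<infinity>\<close>.\<close>

definition subdifferential :: "('a::real_inner \<Rightarrow> ereal) \<Rightarrow> 'a \<Rightarrow> 'a set" where
  "subdifferential f x = {u. \<forall>y. f x + ereal (u \<bullet> (y - x)) \<le> f y}"

text \<open>\<open>Prox f = (Id + \<partial>f)\<^sup>-\<^sup>1\<close>. For proper lower semicontinuous convex \<open>f\<close> on a Hilbert space, the set
  \<open>{p. x \<in> p + \<partial>f p}\<close> is a singleton for each \<open>x\<close>, and \<open>Prox f x\<close> denotes its element.\<close>

definition Prox :: "('a::real_inner \<Rightarrow> ereal) \<Rightarrow> 'a \<Rightarrow> 'a" where
  "Prox f x = (THE p. x \<in> (\<lambda>u. p + u) ` subdifferential f p)"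

definition fenchel_conj :: "('a::real_inner \<Rightarrow> ereal) \<Rightarrow> 'a \<Rightarrow> ereal" where
  "fenchel_conj f u = (SUP x. ereal (u \<bullet> x) - f x)"

definition Fix :: "('a \<Rightarrow> 'a) \<Rightarrow> 'a set" where
  "Fix T = {x. T x = x}"

text \<open>Conjugates of proper functions are never \<open>-\<infinity>\<close>, so the differences below are unambiguous.\<close>

definition dual_objective ::
  "('a::real_inner \<Rightarrow> ereal) \<Rightarrow> ('a \<Rightarrow> ereal) \<Rightarrow> real \<Rightarrow> real \<Rightarrow> 'a \<Rightarrow> ereal" where
  "dual_objective f1 f2 l1 l2 \<phi> =
     - fenchel_conj (\<lambda>x. f1 x / ereal l2) (- \<phi>) - fenchel_conj (\<lambda>x. f2 x / ereal l1) \<phi>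
     - ereal ((norm \<phi>)\<^sup>2 / 2)"

definition dual_solution ::
  "('a::real_inner \<Rightarrow> ereal) \<Rightarrow> ('a \<Rightarrow> ereal) \<Rightarrow> real \<Rightarrow> real \<Rightarrow> 'a \<Rightarrow> bool" where
  "dual_solution f1 f2 l1 l2 \<phi> \<longleftrightarrow>
     \<bar>dual_objective f1 f2 l1 l2 \<phi>\<bar> \<noteq> \<infinity> \<and>
     (\<forall>\<psi>. dual_objective f1 f2 l1 l2 \<psi> \<le> dual_objective f1 f2 l1 l2 \<phi>)"

end

theory Submission
  imports Defs
begin

text \<open>
  Write \<open>g1 = f1/l2\<close> and \<open>g2 = f2/l1\<close>. Both fixed point sets describe the same pairs of points.
  On the one hand \<open>y \<in> F\<close> means that, with \<open>x = P1 y\<close>,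
  \<open>y - x \<in> \<partial>g1 x\<close> and \<open>x - y \<in> \<partial>g2 y\<close>.
  On the other hand, if \<open>z = l1 x + l2 y\<close> then \<open>z - x = l2 (y - x)\<close> and \<open>z - y = l1 (x - y)\<close>
  because \<open>l1 + l2 = 1\<close>; so the same two inclusions say exactly that \<open>x = Prox f1 z\<close> and
  \<open>y = Prox f2 z\<close>. Hence \<open>y \<mapsto> l1 x + l2 y\<close> and \<open>z \<mapsto> Prox f2 z\<close> are mutually inverse.

  Duality identifies the difference \<open>x - y\<close> (\<open>dual_solution_eq_gap\<close>). By the Fenchel--Young
  inequality at \<open>x\<close> and \<open>y\<close>, the dual objective at any \<open>\<phi>\<close> is at most its value at \<open>x - y\<close> minus
  \<open>\<parallel>\<phi> - (x - y)\<parallel>\<^sup>2 / 2\<close>, so a maximizer must equal \<open>x - y\<close>. Therefore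
  \<open>l1 x + l2 y = y + l1 \<phi>\<close> for every \<open>y \<in> F\<close>: the bijection is a translation, and its
  continuity in both directions is immediate.

  The argument rests on \<open>Prox_eq_iff\<close>, that is, on existence and uniqueness of \<open>p\<close> with
  \<open>x - p \<in> \<partial>f p\<close>. Uniqueness is monotonicity of the subdifferential. For existence,
  \<open>f + \<parallel>\<cdot> - x\<parallel>\<^sup>2 / 2\<close> is minimized: it is bounded below (\<open>norm_minorant\<close>), its uniform convexity
  makes minimizing sequences Cauchy, and its minimizer satisfies the inclusion.
\<close>

section \<open>Lower semicontinuous convex functions in terms of real numbers\<close>

lemma proper_obtains_real:
  assumes "proper f"
  obtains x a where "f x = ereal a"
proof -
  from assms obtain x where "f x \<noteq> \<infinity>" "f x \<noteq> -\<infinity>" unfolding proper_def by blast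
  then show thesis using that by (cases "f x") auto
qed

text \<open>The lower limit along \<^term>\<open>at x\<close> does not see the value at \<^term>\<open>x\<close>; stated with \<^term>\<open>nhds x\<close>,
  lower semicontinuity applies to sequences that may hit their limit.\<close>

lemma lower_semicont_eventually:
  assumes "lower_semicont f" "c < f x"
  shows "eventually (\<lambda>y. c < f y) (nhds x)"
proof -
  have "f x \<le> Liminf (at x) f" using assms(1) unfolding lower_semicont_def by blast
  with assms(2) have "eventually (\<lambda>y. c < f y) (at x)" by (simp add: le_Liminf_iff)
  with assms(2) show ?thesis unfolding eventually_at_filter by (auto elim: eventually_mono)
qed

text \<open>Convexity of the epigraph: with real upper bounds in place of the values of \<^term>\<open>f\<close>, all
  further computations take place in the real numbers.\<close>

lemma convex_ereal_le:
  assumes "convex_ereal f" "f x \<le> ereal a" "f y \<le> ereal b" "0 \<le> t" "t \<le> 1"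
  shows "f ((1 - t) *\<^sub>R x + t *\<^sub>R y) \<le> ereal ((1 - t) * a + t * b)"
proof -
  have "f ((1 - t) *\<^sub>R x + t *\<^sub>R y) \<le> ereal (1 - t) * f x + ereal t * f y"
    using assms unfolding convex_ereal_def by auto
  also have "\<dots> \<le> ereal (1 - t) * ereal a + ereal t * ereal b"
    using assms by (intro add_mono ereal_mult_left_mono) auto
  finally show ?thesis by simp
qed

lemma proper_divide:
  assumes "proper f" "l > 0"
  shows "proper (\<lambda>x. f x / ereal l)"
proof -
  have "f x / ereal l \<noteq> -\<infinity>" for x
    using assms unfolding proper_def by (cases "f x") auto
  moreover obtain x a where "f x = ereal a" using proper_obtains_real[OF assms(1)] .
  then have "f x / ereal l \<noteq> \<infinity>" using assms(2) by simp
  ultimately show ?thesis unfolding proper_def by blast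
qed

lemma lower_semicont_divide:
  assumes "lower_semicont f" "l > 0"
  shows "lower_semicont (\<lambda>x. f x / ereal l)"
  unfolding lower_semicont_def le_Liminf_iff
proof (intro allI impI)
  fix x c assume "c < f x / ereal l"
  with assms(2) have "ereal l * c < f x" by (subst (asm) ereal_less_divide_pos) auto
  then have "eventually (\<lambda>y. ereal l * c < f y) (at x)"
    using assms(1) unfolding lower_semicont_def le_Liminf_iff by blast
  then show "eventually (\<lambda>y. c < f y / ereal l) (at x)"
    by eventually_elim (use assms(2) in \<open>simp add: ereal_less_divide_pos\<close>)
qed

lemma convex_ereal_divide:
  assumes "proper f" "convex_ereal f" "l > 0"
  shows "convex_ereal (\<lambda>x. f x / ereal l)"
  unfolding convex_ereal_def
proof (intro allI ballI)
  fix x y and t :: real assume t: "t \<in> {0..1}"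
  have "f ((1 - t) *\<^sub>R x + t *\<^sub>R y) / ereal l \<le> (ereal (1 - t) * f x + ereal t * f y) / ereal l"
    using assms t unfolding convex_ereal_def by (intro ereal_divide_right_mono) auto
  also have "\<dots> = ereal (1 - t) * (f x / ereal l) + ereal t * (f y / ereal l)"
    using assms t unfolding proper_def
    by (cases "f x"; cases "f y"; cases "t = 0"; cases "t = 1") (auto simp: field_simps)
  finally show "f ((1 - t) *\<^sub>R x + t *\<^sub>R y) / ereal l
      \<le> ereal (1 - t) * (f x / ereal l) + ereal t * (f y / ereal l)" .
qed

text \<open>A convex function decreases at most linearly away from a point near which it is bounded below.
  Lower semicontinuity gives \<open>f > a - 1\<close> on a ball of radius \<open>r\<close> about \<open>x0\<close>. If \<open>p\<close> lies farther
  away, the segment from \<open>x0\<close> to \<open>p\<close> meets the sphere of radius \<open>r\<close>, and a too negative value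
  \<open>f p\<close> would by convexity force \<open>f\<close> below \<open>a - 1\<close> there. Linear decrease is what the quadratic term
  of the proximal problem can compensate.\<close>

lemma norm_minorant:
  fixes f :: "'a::real_inner \<Rightarrow> ereal"
  assumes "proper f" "lower_semicont f" "convex_ereal f"
  shows "\<exists>x0 a r. r > 0 \<and> f x0 = ereal a \<and> (\<forall>p. ereal (a - 1 - norm (p - x0) / r) \<le> f p)"
proof -
  obtain x0 a where a: "f x0 = ereal a" using proper_obtains_real[OF assms(1)] .
  have "eventually (\<lambda>y. ereal (a - 1) < f y) (nhds x0)"
    using assms(2) a by (intro lower_semicont_eventually) auto
  then obtain e where e: "e > 0" "\<And>y. dist y x0 < e \<Longrightarrow> ereal (a - 1) < f y"
    unfolding eventually_nhds_metric by blast
  (* Strictly smaller than e, so that the sphere of radius r still lies in the open ball. *)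
  define r where "r = e / 2"
  have r: "r > 0" "r < e" using e(1) by (auto simp: r_def)
  have "ereal (a - 1 - norm (p - x0) / r) \<le> f p" for p
  proof (cases "norm (p - x0) \<le> r")
    case True
    then have "ereal (a - 1) < f p" using e r by (auto simp: dist_norm)
    moreover have "ereal (a - 1 - norm (p - x0) / r) \<le> ereal (a - 1)" using r by simp
    ultimately show ?thesis by order
  next
    case False
    define t where "t = r / norm (p - x0)"
    have n: "norm (p - x0) > 0" using False r by linarith
    have t: "0 < t" "t \<le> 1" using False r n by (auto simp: t_def)
    define q where "q = (1 - t) *\<^sub>R x0 + t *\<^sub>R p"
    have "q - x0 = t *\<^sub>R (p - x0)" by (simp add: q_def algebra_simps)
    then have "dist q x0 = r" using t n using r by (simp add: dist_norm t_def)
    then have q: "ereal (a - 1) < f q" using e r by simp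
    show ?thesis
    proof (rule ereal_le_real)
      fix b assume "f p \<le> ereal b"
      then have "f q \<le> ereal ((1 - t) * a + t * b)"
        unfolding q_def using a t assms(3) by (intro convex_ereal_le) auto
      with q have "ereal (a - 1) < ereal ((1 - t) * a + t * b)" by (rule less_le_trans)
      then have "t * (a - b) < 1" by (simp add: algebra_simps)
      then have "a - b < 1 / t" using t by (simp add: field_simps)
      moreover have "1 / t = norm (p - x0) / r" by (simp add: t_def)
      ultimately show "ereal (a - 1 - norm (p - x0) / r) \<le> ereal b" by simp
    qed
  qed
  with r a show ?thesis by blast
qed

section \<open>Existence and uniqueness of proximal points\<close>

text \<open>For a minimizing sequence \<open>q n\<close> the midpoint of \<open>q n\<close> and \<open>q k\<close> is a competitor whose value lies
  below the average of the two values by at least \<open>\<parallel>q n - q k\<parallel>\<^sup>2 / 8\<close>, by the parallelogram law. As no value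
  falls below the infimum, the sequence is Cauchy; completeness gives a limit, and lower semicontinuity
  shows that the infimum is attained there. The real numbers \<open>a\<close> range over upper bounds of the
  values, so that only finite values of \<^term>\<open>f\<close> are involved.\<close>

lemma proximal_minimizer:
  fixes f :: "'a::{real_inner, complete_space} \<Rightarrow> ereal" and x :: 'a
  assumes f: "proper f" "lower_semicont f" "convex_ereal f"
  obtains p b where "f p = ereal b"
    "\<And>q a. f q \<le> ereal a \<Longrightarrow> b + (norm (p - x))\<^sup>2 / 2 \<le> a + (norm (q - x))\<^sup>2 / 2"
proof -
  define S where "S = {a + (norm (q - x))\<^sup>2 / 2 | q a. f q \<le> ereal a}"
  define m where "m = Inf S"
  obtain x0 a0 r where r: "r > 0" and a0: "f x0 = ereal a0"
    and minor: "\<And>p. ereal (a0 - 1 - norm (p - x0) / r) \<le> f p"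
    using norm_minorant[OF f] by blast
  have "f x0 \<le> ereal a0" using a0 by simp
  then have "S \<noteq> {}" unfolding S_def by blast
  have "bdd_below S"
  proof (rule bdd_belowI)
    fix s assume "s \<in> S"
    then obtain q a where s: "s = a + (norm (q - x))\<^sup>2 / 2" and "f q \<le> ereal a"
      unfolding S_def by blast
    then have "ereal (a0 - 1 - norm (q - x0) / r) \<le> ereal a" using minor order_trans by blast
    then have 1: "a0 - 1 - norm (q - x0) / r \<le> a" by simp
    have "norm (q - x0) \<le> norm (q - x) + norm (x - x0)"
      using norm_triangle_ineq[of "q - x" "x - x0"] by simp
    then have 2: "norm (q - x0) / r \<le> norm (q - x) / r + norm (x - x0) / r"
      using r by (simp add: field_simps)
    (* The quadratic term dominates the linear one: c * d \<le> c^2/2 + d^2/2 with d = 1/r. *)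
    have "0 \<le> (norm (q - x) - 1 / r)\<^sup>2" by simp
    then have "norm (q - x) / r \<le> (norm (q - x))\<^sup>2 / 2 + (1 / r)\<^sup>2 / 2"
      by (simp add: power2_diff)
    with 1 2 show "a0 - 1 - norm (x - x0) / r - (1 / r)\<^sup>2 / 2 \<le> s" unfolding s by linarith
  qed
  have m: "m \<le> a + (norm (q - x))\<^sup>2 / 2" if "f q \<le> ereal a" for q a
    unfolding m_def using that \<open>bdd_below S\<close> by (intro cInf_lower) (auto simp: S_def)
  define s where "s n = 1 / real (Suc n)" for n
  have s: "s \<longlonglongrightarrow> 0" "s n > 0" "n \<le> k \<Longrightarrow> s k \<le> s n" for n k
    using LIMSEQ_Suc[OF lim_inverse_n'] by (simp_all add: s_def[abs_def] field_simps)
  have "\<exists>q a. f q \<le> ereal a \<and> a + (norm (q - x))\<^sup>2 / 2 < m + s n" for n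
  proof -
    have "Inf S < m + s n" unfolding m_def using s by simp
    then obtain v where "v \<in> S" "v < m + s n" using \<open>S \<noteq> {}\<close> \<open>bdd_below S\<close>
      by (auto simp: cInf_less_iff)
    then show ?thesis unfolding S_def by blast
  qed
  then obtain q a where q: "\<And>n. f (q n) \<le> ereal (a n)"
    "\<And>n. a n + (norm (q n - x))\<^sup>2 / 2 < m + s n" by metis
  have close: "(norm (q n - q k))\<^sup>2 \<le> 4 * (s n + s k)" for n k
  proof -
    define c where "c = (1 - 1/2) *\<^sub>R q n + (1/2) *\<^sub>R q k"
    have "f c \<le> ereal ((1 - 1/2) * a n + 1/2 * a k)"
      unfolding c_def using q f by (intro convex_ereal_le) auto
    from m[OF this] have 1: "m \<le> (a n + a k) / 2 + (norm (c - x))\<^sup>2 / 2" by (simp add: field_simps)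
    have "c - x = (1/2) *\<^sub>R ((q n - x) + (q k - x))"
      by (simp add: c_def algebra_simps flip: scaleR_add_left)
    then have "(norm (c - x))\<^sup>2 = (norm ((q n - x) + (q k - x)))\<^sup>2 / 4"
      by (simp add: power_mult_distrib power_divide)
    moreover have "(norm ((q n - x) + (q k - x)))\<^sup>2
        = 2 * (norm (q n - x))\<^sup>2 + 2 * (norm (q k - x))\<^sup>2 - (norm (q n - q k))\<^sup>2"
      unfolding power2_norm_eq_inner by (simp add: algebra_simps inner_commute)
    ultimately show ?thesis using 1 q(2)[of n] q(2)[of k] by argo
  qed
  have "Cauchy q"
  proof (rule metric_CauchyI)
    fix e :: real assume e: "e > 0"
    have "eventually (\<lambda>n. s n < e\<^sup>2 / 8) sequentially"
      using e by (intro order_tendstoD(2)[OF s(1)]) simp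
    then obtain N where N: "s N < e\<^sup>2 / 8" by (auto simp: eventually_sequentially)
    have "dist (q n) (q k) < e" if "n \<ge> N" "k \<ge> N" for n k
    proof -
      have "s n \<le> s N" "s k \<le> s N" using that s by auto
      then have "(norm (q n - q k))\<^sup>2 < e\<^sup>2" using close[of n k] N by argo
      then show ?thesis using e by (simp add: dist_norm power2_less_imp_less)
    qed
    then show "\<exists>M. \<forall>m\<ge>M. \<forall>n\<ge>M. dist (q m) (q n) < e" by blast
  qed
  then obtain p where p: "q \<longlonglongrightarrow> p" using Cauchy_convergent convergent_def by blast
  have lim: "(\<lambda>n. m + s n - (norm (q n - x))\<^sup>2 / 2) \<longlonglongrightarrow> m + 0 - (norm (p - x))\<^sup>2 / 2"
    by (intro tendsto_intros s p) auto
  have le: "f p \<le> ereal (m - (norm (p - x))\<^sup>2 / 2)"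
  proof (rule ccontr)
    assume "\<not> ?thesis"
    then have "ereal (m - (norm (p - x))\<^sup>2 / 2) < f p" by simp
    then obtain d where d: "m - (norm (p - x))\<^sup>2 / 2 < d" "ereal d < f p"
      using ereal_dense2 by (metis ereal_less(2) less_ereal.simps(1))
    have "eventually (\<lambda>n. ereal d < f (q n)) sequentially"
      using eventually_compose_filterlim[OF lower_semicont_eventually[OF f(2) d(2)] p] .
    moreover have "eventually (\<lambda>n. m + s n - (norm (q n - x))\<^sup>2 / 2 < d) sequentially"
      using order_tendstoD(2)[OF lim] d(1) by simp
    ultimately have "eventually (\<lambda>n. False) sequentially"
    proof eventually_elim
      case (elim n)
      then have "ereal d < ereal (a n)" using q(1)[of n] by order
      with elim q(2)[of n] show False by simp
    qed
    then show False by simp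
  qed
  then obtain b where b: "f p = ereal b" using f(1) unfolding proper_def by (cases "f p") auto
  with le have "b + (norm (p - x))\<^sup>2 / 2 \<le> m" by simp
  with that b m show thesis by (meson order_trans)
qed

text \<open>The minimizer \<open>p\<close> is compared with the points \<open>p + t (y - p)\<close> of the segment towards \<open>y\<close>. Convexity
  bounds \<open>f\<close> there, and the quadratic term contributes \<open>t \<langle>p - x, y - p\<rangle>\<close> up to an error of order
  \<open>t\<^sup>2\<close>; dividing by \<open>t\<close> and letting \<open>t\<close> tend to \<open>0\<close> leaves the subgradient inequality.\<close>

lemma ex_proximal_point:
  fixes f :: "'a::{real_inner, complete_space} \<Rightarrow> ereal" and x :: 'a
  assumes f: "proper f" "lower_semicont f" "convex_ereal f"
  shows "\<exists>p. x - p \<in> subdifferential f p"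
proof -
  obtain p b where b: "f p = ereal b" and
    min: "\<And>q a. f q \<le> ereal a \<Longrightarrow> b + (norm (p - x))\<^sup>2 / 2 \<le> a + (norm (q - x))\<^sup>2 / 2"
    using proximal_minimizer[OF f] by blast
  have "f p + ereal ((x - p) \<bullet> (y - p)) \<le> f y" for y
  proof (rule ereal_le_real)
    fix a assume a: "f y \<le> ereal a"
    (* u is the amount by which the subgradient inequality fails at y; the goal is u \<le> 0. *)
    define u where "u = b + (x - p) \<bullet> (y - p) - a"
    define N where "N = (norm (y - p))\<^sup>2 / 2"
    have small: "u \<le> t * N" if t: "0 < t" "t \<le> 1" for t
    proof -
      have "f ((1 - t) *\<^sub>R p + t *\<^sub>R y) \<le> ereal ((1 - t) * b + t * a)"
        using f a b t by (intro convex_ereal_le) auto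
      from min[OF this]
      have "b + (norm (p - x))\<^sup>2 / 2
          \<le> (1 - t) * b + t * a + (norm ((1 - t) *\<^sub>R p + t *\<^sub>R y - x))\<^sup>2 / 2" .
      moreover have "(1 - t) *\<^sub>R p + t *\<^sub>R y - x = (p - x) + t *\<^sub>R (y - p)"
        by (simp add: algebra_simps)
      moreover have "(norm ((p - x) + t *\<^sub>R (y - p)))\<^sup>2
          = (norm (p - x))\<^sup>2 + t * (t * (norm (y - p))\<^sup>2) - 2 * t * ((x - p) \<bullet> (y - p))"
        unfolding power2_norm_eq_inner by (simp add: algebra_simps inner_commute)
      ultimately have "t * u \<le> t * (t * N)"
        unfolding u_def N_def by (simp add: algebra_simps)
      then show ?thesis using t by simp
    qed
    have "((\<lambda>t. t * N) \<longlongrightarrow> 0 * N) (at_right 0)" by (intro tendsto_intros)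
    moreover have "eventually (\<lambda>t::real. u \<le> t * N) (at_right 0)"
      using eventually_at_right_real[of 0 "1::real"] by (auto elim!: eventually_mono intro: small)
    ultimately have "u \<le> 0" using tendsto_lowerbound[of "\<lambda>t. t * N" "0 * N" "at_right 0" u] by simp
    then show "f p + ereal ((x - p) \<bullet> (y - p)) \<le> ereal a" by (simp add: b u_def)
  qed
  then show ?thesis unfolding subdifferential_def by blast
qed

lemma subdifferential_finite:
  assumes "proper f" "u \<in> subdifferential f x"
  obtains a where "f x = ereal a"
proof -
  obtain y b where "f y = ereal b" using proper_obtains_real[OF assms(1)] .
  with assms have "f x + ereal (u \<bullet> (y - x)) \<le> ereal b" unfolding subdifferential_def
    by (metis (mono_tags, lifting) mem_Collect_eq)
  then have "f x \<noteq> \<infinity>" by auto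
  then show thesis using assms(1) that unfolding proper_def by (cases "f x") auto
qed

lemma subdifferential_monotone:
  assumes "proper f" "u \<in> subdifferential f x" "v \<in> subdifferential f y"
  shows "(u - v) \<bullet> (x - y) \<ge> 0"
proof -
  obtain a b where a: "f x = ereal a" and b: "f y = ereal b"
    using assms subdifferential_finite by metis
  have "f x + ereal (u \<bullet> (y - x)) \<le> f y" "f y + ereal (v \<bullet> (x - y)) \<le> f x"
    using assms unfolding subdifferential_def by blast+
  then have "a + u \<bullet> (y - x) \<le> b" "b + v \<bullet> (x - y) \<le> a" unfolding a b by simp_all
  then show ?thesis by (simp add: algebra_simps)
qed

lemma proximal_point_unique:
  assumes "proper f" "x - p \<in> subdifferential f p" "x - q \<in> subdifferential f q"
  shows "p = q"
proof -
  have "((x - p) - (x - q)) \<bullet> (p - q) \<ge> 0" using subdifferential_monotone assms by blast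
  then have "(p - q) \<bullet> (p - q) \<le> 0" by (simp add: algebra_simps inner_commute)
  then show ?thesis by (metis antisym inner_eq_zero_iff inner_ge_zero right_minus_eq)
qed

text \<open>This reduces every statement about proximal maps below to a subgradient inclusion.\<close>

lemma Prox_eq_iff:
  fixes f :: "'a::{real_inner, complete_space} \<Rightarrow> ereal"
  assumes "proper f" "lower_semicont f" "convex_ereal f"
  shows "Prox f x = p \<longleftrightarrow> x - p \<in> subdifferential f p"
proof -
  have iff: "x \<in> (\<lambda>u. q + u) ` subdifferential f q \<longleftrightarrow> x - q \<in> subdifferential f q" for q
    by (force simp: image_iff)
  have "\<exists>!q. x - q \<in> subdifferential f q"
    using ex_proximal_point[OF assms] proximal_point_unique[OF assms(1)] by blast
  then show ?thesis unfolding Prox_def iff by (metis (mono_tags, lifting) the1_equality)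
qed

text \<open>Scaling is what links \<open>Prox (f1/l2)\<close> and \<open>Prox f1\<close>: both are characterized by subgradients of
  the same function \<open>f1\<close>.\<close>

lemma subdifferential_divide:
  assumes "l > 0"
  shows "u \<in> subdifferential (\<lambda>x. f x / ereal l) x \<longleftrightarrow> l *\<^sub>R u \<in> subdifferential f x"
proof -
  have real: "a / l + c \<le> b / l \<longleftrightarrow> a + l * c \<le> b" for a b c
  proof -
    have "a / l + c = (a + l * c) / l" using assms by (simp add: add_divide_distrib)
    then show ?thesis using assms by (simp add: divide_le_cancel)
  qed
  have "f x / ereal l + ereal c \<le> f y / ereal l \<longleftrightarrow> f x + ereal (l * c) \<le> f y" for y c
    using assms real by (cases "f x"; cases "f y") simp_all
  then show ?thesis unfolding subdifferential_def by simp
qed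

section \<open>Duality\<close>

lemma fenchel_young:
  assumes "f x = ereal a"
  shows "ereal (u \<bullet> x - a) \<le> fenchel_conj f u"
  unfolding fenchel_conj_def using assms by (intro SUP_upper2[of x]) auto

text \<open>The equality case of the Fenchel--Young inequality: the subgradient inequality says that the
  supremum defining the conjugate is attained at \<^term>\<open>x\<close>.\<close>

lemma fenchel_conj_subgradient:
  assumes "f x = ereal a" "u \<in> subdifferential f x"
  shows "fenchel_conj f u = ereal (u \<bullet> x - a)"
proof (rule antisym)
  show "fenchel_conj f u \<le> ereal (u \<bullet> x - a)"
    unfolding fenchel_conj_def
  proof (rule SUP_least)
    fix y
    have "ereal a + ereal (u \<bullet> (y - x)) \<le> f y"
      using assms unfolding subdifferential_def by force
    then show "ereal (u \<bullet> y) - f y \<le> ereal (u \<bullet> x - a)"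
      by (cases "f y") (auto simp: algebra_simps)
  qed
qed (use assms fenchel_young in blast)

text \<open>With \<open>\<delta> = x - y\<close> and \<open>a\<close>, \<open>b\<close> the values of the scaled functions at \<open>x\<close>, \<open>y\<close>, the two inclusions
  turn the Fenchel--Young inequalities for \<open>\<delta>\<close> into equalities, so the dual value at \<open>\<delta>\<close> is
  \<open>a + b + \<parallel>\<delta>\<parallel>\<^sup>2 / 2\<close>. At an arbitrary \<open>\<phi>\<close> the inequalities give at most
  \<open>a + b + \<langle>\<phi>, \<delta>\<rangle> - \<parallel>\<phi>\<parallel>\<^sup>2 / 2\<close>, which is smaller than the value at \<open>\<delta>\<close> by \<open>\<parallel>\<phi> - \<delta>\<parallel>\<^sup>2 / 2\<close>.\<close>

lemma dual_solution_eq_gap: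
  fixes f1 f2 :: "'a::real_inner \<Rightarrow> ereal"
  assumes "proper f1" "proper f2" "l1 > 0" "l2 > 0" "dual_solution f1 f2 l1 l2 \<phi>"
    and x: "y - x \<in> subdifferential (\<lambda>x. f1 x / ereal l2) x"
    and y: "x - y \<in> subdifferential (\<lambda>x. f2 x / ereal l1) y"
  shows "\<phi> = x - y"
proof -
  let ?g1 = "\<lambda>x. f1 x / ereal l2" and ?g2 = "\<lambda>x. f2 x / ereal l1"
  define \<delta> where "\<delta> = x - y"
  obtain a b where a: "?g1 x = ereal a" and b: "?g2 y = ereal b"
    using subdifferential_finite[OF proper_divide x] subdifferential_finite[OF proper_divide y]
      assms by metis
  have "fenchel_conj ?g1 (- \<delta>) = ereal (- \<delta> \<bullet> x - a)" "fenchel_conj ?g2 \<delta> = ereal (\<delta> \<bullet> y - b)"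
    using fenchel_conj_subgradient[OF a x] fenchel_conj_subgradient[OF b y] by (simp_all add: \<delta>_def)
  then have "dual_objective f1 f2 l1 l2 \<delta> = ereal (a + b + (norm \<delta>)\<^sup>2 / 2)"
    unfolding dual_objective_def by (simp add: \<delta>_def power2_norm_eq_inner algebra_simps)
  then have lower: "ereal (a + b + (norm \<delta>)\<^sup>2 / 2) \<le> dual_objective f1 f2 l1 l2 \<phi>"
    using assms(5) unfolding dual_solution_def by metis
  have "ereal (- \<phi> \<bullet> x - a) \<le> fenchel_conj ?g1 (- \<phi>)" "ereal (\<phi> \<bullet> y - b) \<le> fenchel_conj ?g2 \<phi>"
    using fenchel_young[of ?g1 x a "- \<phi>"] fenchel_young[of ?g2 y b \<phi>] a b by simp_all
  then have "dual_objective f1 f2 l1 l2 \<phi>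
      \<le> - ereal (- \<phi> \<bullet> x - a) - ereal (\<phi> \<bullet> y - b) - ereal ((norm \<phi>)\<^sup>2 / 2)"
    unfolding dual_objective_def by (intro ereal_minus_mono ereal_minus_le_minus[THEN iffD2]) auto
  also have "\<dots> = ereal (a + b + (norm \<delta>)\<^sup>2 / 2 - (norm (\<phi> - \<delta>))\<^sup>2 / 2)"
    by (simp add: \<delta>_def power2_norm_eq_inner algebra_simps inner_commute diff_divide_distrib add_divide_distrib)
  finally have "ereal (a + b + (norm \<delta>)\<^sup>2 / 2)
      \<le> ereal (a + b + (norm \<delta>)\<^sup>2 / 2 - (norm (\<phi> - \<delta>))\<^sup>2 / 2)" using lower by order
  then show ?thesis by (simp add: \<delta>_def)
qed

section \<open>The two fixed point sets\<close>

text \<open>The inclusions from the definition of \<open>F\<close> are turned into inclusions for \<open>f1\<close> and \<open>f2\<close> at the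
  point \<open>z = l1 x + l2 y\<close> and back. Continuity is read off from the fact that \<open>T2\<close> and \<open>Prox f2\<close> act on
  \<open>F\<close> and \<open>G\<close> as the translations by \<open>l1 \<phi>\<close> and \<open>- l1 \<phi>\<close>.\<close>

theorem theorem4p13:
  fixes f1 f2 :: "'a::{real_inner, complete_space} \<Rightarrow> ereal"
    and l1 l2 :: real
    and \<phi> :: 'a
  assumes "proper f1" and "lower_semicont f1" and "convex_ereal f1"
    and "proper f2" and "lower_semicont f2" and "convex_ereal f2"
    and "l1 > 0" and "l2 > 0" and "l1 + l2 = 1"
    and "dual_solution f1 f2 l1 l2 \<phi>"
  shows "let P1 = Prox (\<lambda>x. f1 x / ereal l2);
             P2 = Prox (\<lambda>x. f2 x / ereal l1);
             F = Fix (P2 \<circ> P1);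
             G = Fix (\<lambda>z. l1 *\<^sub>R Prox f1 z + l2 *\<^sub>R Prox f2 z);
             T2 = (\<lambda>y. l1 *\<^sub>R P1 y + l2 *\<^sub>R y)
         in (\<forall>y\<in>F. T2 y = y + l1 *\<^sub>R \<phi>) \<and>
            homeomorphism F G T2 (Prox f2) \<and>
            G = (\<lambda>y. y + l1 *\<^sub>R \<phi>) ` F"
proof -
  define P1 where "P1 = Prox (\<lambda>x. f1 x / ereal l2)"
  define P2 where "P2 = Prox (\<lambda>x. f2 x / ereal l1)"
  define F where "F = Fix (P2 \<circ> P1)"
  define G where "G = Fix (\<lambda>z. l1 *\<^sub>R Prox f1 z + l2 *\<^sub>R Prox f2 z)"
  define T where "T = (\<lambda>y. l1 *\<^sub>R P1 y + l2 *\<^sub>R y)"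
  note prox1 = Prox_eq_iff[OF assms(1-3)] and prox2 = Prox_eq_iff[OF assms(4-6)]
  have P1: "P1 z = p \<longleftrightarrow> l2 *\<^sub>R (z - p) \<in> subdifferential f1 p" for z p
    unfolding P1_def subdifferential_divide[OF \<open>l2 > 0\<close>, symmetric]
    using assms by (intro Prox_eq_iff proper_divide lower_semicont_divide convex_ereal_divide)
  have P2: "P2 z = p \<longleftrightarrow> l1 *\<^sub>R (z - p) \<in> subdifferential f2 p" for z p
    unfolding P2_def subdifferential_divide[OF \<open>l1 > 0\<close>, symmetric]
    using assms by (intro Prox_eq_iff proper_divide lower_semicont_divide convex_ereal_divide)
  have l2: "l2 = 1 - l1" using assms by simp
  (* The residuals at z = l1 p + l2 q are multiples of the gap between p and q; the factors cancel
     those of the scaled functions. *)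
  have split: "l1 *\<^sub>R p + l2 *\<^sub>R q - p = l2 *\<^sub>R (q - p)" "l1 *\<^sub>R p + l2 *\<^sub>R q - q = l1 *\<^sub>R (p - q)" for p q :: 'a
    unfolding l2 by (simp_all add: algebra_simps)
  have F: "y \<in> F \<longleftrightarrow> l1 *\<^sub>R (P1 y - y) \<in> subdifferential f2 y" for y
    unfolding F_def Fix_def by (simp add: P2)
  have T_eq: "T y = y + l1 *\<^sub>R \<phi>" if "y \<in> F" for y
  proof -
    have "l2 *\<^sub>R (y - P1 y) \<in> subdifferential f1 (P1 y)" using P1 by blast
    with that have "\<phi> = P1 y - y"
      using assms by (intro dual_solution_eq_gap) (auto simp: F subdifferential_divide)
    then have "P1 y = y + \<phi>" by simp
    then show ?thesis unfolding T_def l2 by (simp add: algebra_simps)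
  qed
  have T_into: "T y \<in> G" and inv_T: "Prox f2 (T y) = y" if "y \<in> F" for y
  proof -
    have "Prox f1 (T y) = P1 y" unfolding prox1 T_def split using P1 by blast
    moreover show "Prox f2 (T y) = y" unfolding prox2 T_def split using that F by blast
    ultimately show "T y \<in> G" unfolding G_def Fix_def by (simp add: T_def)
  qed
  have Prox_into: "Prox f2 z \<in> F" and T_inv: "T (Prox f2 z) = z" if "z \<in> G" for z
  proof -
    have z: "l1 *\<^sub>R Prox f1 z + l2 *\<^sub>R Prox f2 z = z" using that unfolding G_def Fix_def by simp
    have "z - Prox f1 z \<in> subdifferential f1 (Prox f1 z)" "z - Prox f2 z \<in> subdifferential f2 (Prox f2 z)"
      using prox1 prox2 by blast+
    then have "l2 *\<^sub>R (Prox f2 z - Prox f1 z) \<in> subdifferential f1 (Prox f1 z)"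
      and sub2: "l1 *\<^sub>R (Prox f1 z - Prox f2 z) \<in> subdifferential f2 (Prox f2 z)"
      using split[of "Prox f1 z" "Prox f2 z"] unfolding z by simp_all
    then have "P1 (Prox f2 z) = Prox f1 z" using P1 by blast
    then show "Prox f2 z \<in> F" "T (Prox f2 z) = z" using sub2 z by (simp_all add: F T_def)
  qed
  have Prox_eq: "Prox f2 z = z - l1 *\<^sub>R \<phi>" if "z \<in> G" for z
    using T_eq[OF Prox_into[OF that]] T_inv[OF that] by (simp add: algebra_simps)
  have "continuous_on F T"
    using T_eq by (subst continuous_on_cong[OF refl]) (auto intro!: continuous_intros)
  moreover have "continuous_on G (Prox f2)"
    using Prox_eq by (subst continuous_on_cong[OF refl]) (auto intro!: continuous_intros)
  ultimately have "homeomorphism F G T (Prox f2)"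
    using T_into inv_T Prox_into T_inv by (intro homeomorphismI) auto
  moreover from this have "G = (\<lambda>y. y + l1 *\<^sub>R \<phi>) ` F"
    using T_eq unfolding homeomorphism_def by (metis (no_types, lifting) image_cong)
  ultimately show ?thesis
    using T_eq unfolding Let_def P1_def P2_def F_def G_def T_def by blast
qed

end
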